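(* Let $G$ be a finite simple graph on $n$ vertices. If $\delta(G)\geq \tilde\alpha(G)$, then $G$ is pancyclic, unless $G$ is the complete bipartite graph $K_{\frac{n}{2},\frac{n}{2}}$.
   Context: $\delta(G)$ denotes the minimum degree of $G$. The bipartite independence number $\tilde\alpha(G)$ is the minimal number $k$ such that there exist positive integers $a$ and $b$ with $a+b=k+1$ with the property that for any two disjoint sets $A,B\subseteq V(G)$ with $|A|=a$ and $|B|=b$, there is an edge of $G$ between $A$ and $B$. An $n$-vertex graph is pancyclic if it contains a cycle of length $\ell$ for every integer $\ell$ with $3\leq \ell\leq n$. *)

theory Defs
  imports Main
begin

definition simple_graph :: "'a set \<Rightarrow> ('a \<Rightarrow> 'a \<Rightarrow> bool) \<Rightarrow> bool" where
  "simple_graph V E \<longleftrightarrow> finite V \<and> (\<forall>x y. E x y \<longrightarrow> x \<in> V \<and> y \<in> V)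
     \<and> (\<forall>x y. E x y \<longrightarrow> E y x) \<and> (\<forall>x. \<not> E x x)"

definition degree :: "'a set \<Rightarrow> ('a \<Rightarrow> 'a \<Rightarrow> bool) \<Rightarrow> 'a \<Rightarrow> nat" where
  "degree V E v = card {u \<in> V. E v u}"

definition min_degree :: "'a set \<Rightarrow> ('a \<Rightarrow> 'a \<Rightarrow> bool) \<Rightarrow> nat" where
  "min_degree V E = Min (degree V E ` V)"

definition bip_indep_number :: "'a set \<Rightarrow> ('a \<Rightarrow> 'a \<Rightarrow> bool) \<Rightarrow> nat" where
  "bip_indep_number V E = (LEAST k. \<exists>a b. a > 0 \<and> b > 0 \<and> a + b = k + 1 \<and>
     (\<forall>A B. A \<subseteq> V \<and> B \<subseteq> V \<and> A \<inter> B = {} \<and> card A = a \<and> card B = b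
        \<longrightarrow> (\<exists>x\<in>A. \<exists>y\<in>B. E x y)))"

definition has_cycle_of_length :: "'a set \<Rightarrow> ('a \<Rightarrow> 'a \<Rightarrow> bool) \<Rightarrow> nat \<Rightarrow> bool" where
  "has_cycle_of_length V E l \<longleftrightarrow> l \<ge> 3 \<and> (\<exists>cs. length cs = l \<and> distinct cs \<and> set cs \<subseteq> V
     \<and> (\<forall>i. Suc i < l \<longrightarrow> E (cs ! i) (cs ! Suc i)) \<and> E (last cs) (hd cs))"

definition pancyclic :: "'a set \<Rightarrow> ('a \<Rightarrow> 'a \<Rightarrow> bool) \<Rightarrow> bool" where
  "pancyclic V E \<longleftrightarrow> (\<forall>l. 3 \<le> l \<and> l \<le> card V \<longrightarrow> has_cycle_of_length V E l)"

definition is_balanced_complete_bipartite :: "'a set \<Rightarrow> ('a \<Rightarrow> 'a \<Rightarrow> bool) \<Rightarrow> bool" where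
  "is_balanced_complete_bipartite V E \<longleftrightarrow> (\<exists>X Y. X \<union> Y = V \<and> X \<inter> Y = {} \<and> card X = card Y
     \<and> (\<forall>x\<in>V. \<forall>y\<in>V. E x y \<longleftrightarrow> (x \<in> X \<and> y \<in> Y) \<or> (x \<in> Y \<and> y \<in> X)))"

end

theory Submission
  imports Defs
begin

text \<open>
Fix \<open>a \<le> b\<close> attaining the bipartite independence number, so that disjoint sets of sizes \<open>a\<close> and
\<open>b\<close> always span an edge and all degrees are at least \<open>a + b - 1\<close>. A triangle-free such graph
is a balanced complete bipartite graph, since every neighbourhood is then a largest independent set.

Otherwise consider a gadget of order \<open>k\<close>: a cycle of length \<open>k\<close> with one
edge (between the last and the first vertex of \<open>vs\<close>) that forms a triangle with an outside vertex
\<open>z\<close>. It provides cycles of lengths \<open>k\<close> and \<open>k + 1\<close>, and a triangle is a gadget of order 2.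
So it suffices to pass from order \<open>k\<close> to order \<open>k + 1\<close> or \<open>k + 2\<close>. Suppose that this is
impossible, and let \<open>W\<close> be the nonempty set of the remaining vertices.
First, for \<open>w \<in> W\<close> the predecessors on the path of the neighbours of \<open>w\<close> form an independent
set without edges to \<open>w\<close> and its neighbours in \<open>W\<close>; the hole condition forces
\<open>w\<close> to have at least \<open>b\<close> neighbours in \<open>W\<close>. If \<open>w\<close> is adjacent to \<open>z\<close>, or to both ends of the
path, one vertex is missing in this count, and it is supplied by rerouting through another triangle.
Secondly, crossing over through an edge of \<open>W\<close> shows that a path vertex next to one with a
neighbour in \<open>W\<close> has at least \<open>b - 2\<close> neighbours in \<open>W\<close>. Finally, path vertices at distance 3
cannot have distinct neighbours in \<open>W\<close>, because those are joined inside \<open>W\<close> by a path on 3 or 4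
vertices. This leaves only \<open>k \<le> 3\<close>, where the hole condition applies directly.
\<close>

section \<open>Graphs without bipartite holes\<close>

locale hole_free_graph =
  fixes V :: "'a set" and E :: "'a \<Rightarrow> 'a \<Rightarrow> bool" and a b :: nat
  assumes fin: "finite V"
    and edge_in: "E x y \<Longrightarrow> x \<in> V \<and> y \<in> V"
    and sym: "E x y \<Longrightarrow> E y x"
    and irrefl: "\<not> E x x"
    and a_pos: "1 \<le> a"
    and a_le_b: "a \<le> b"
    and hole_exact: "\<lbrakk>A \<subseteq> V; B \<subseteq> V; A \<inter> B = {}; card A = a; card B = b\<rbrakk> \<Longrightarrow> \<exists>x\<in>A. \<exists>y\<in>B. E x y"
    and min_deg: "v \<in> V \<Longrightarrow> a + b \<le> Suc (card {u. E v u})"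
begin

lemma E_sym: "E x y \<longleftrightarrow> E y x"
  using sym by blast

lemma fin_subset: "A \<subseteq> V \<Longrightarrow> finite A"
  using fin finite_subset by blast

lemma finite_nbrs [simp]: "finite {u. E v u}"
  by (rule fin_subset) (use edge_in in blast)

lemma hole:
  assumes "A \<subseteq> V" "B \<subseteq> V" "A \<inter> B = {}" "a \<le> card A" "b \<le> card B"
  shows "\<exists>x\<in>A. \<exists>y\<in>B. E x y"
proof -
  obtain A' where "A' \<subseteq> A" "card A' = a" using assms(4) by (meson obtain_subset_with_card_n)
  moreover obtain B' where "B' \<subseteq> B" "card B' = b" using assms(5) by (meson obtain_subset_with_card_n)
  ultimately show ?thesis using hole_exact[of A' B'] assms(1-3) by blast
qed

text \<open>The typical use of the hole condition: \<open>A\<^sub>1 - A\<^sub>0\<close> consists of isolated vertices of \<open>X\<close>, so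
  that a part of it can be moved to either side to get the sizes right.\<close>

lemma hole_between:
  assumes X: "X \<subseteq> V" "a + b \<le> card X"
    and A: "A\<^sub>0 \<subseteq> A\<^sub>1" "A\<^sub>1 \<subseteq> X" "card A\<^sub>0 \<le> a" "a \<le> card A\<^sub>1"
    and edges: "\<And>x y. x \<in> A\<^sub>0 \<Longrightarrow> y \<in> X - A\<^sub>0 \<Longrightarrow> \<not> E x y"
      "\<And>x y. x \<in> A\<^sub>1 - A\<^sub>0 \<Longrightarrow> y \<in> X \<Longrightarrow> \<not> E x y"
  shows False
proof -
  have "finite A\<^sub>1" using A X fin_subset by blast
  then obtain A' where A': "A\<^sub>0 \<subseteq> A'" "A' \<subseteq> A\<^sub>1" "card A' = a"
    using exists_subset_between[OF A(3,4,1)] by blast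
  have "card (X - A') = card X - a"
    using A' A X by (metis card_Diff_subset finite_subset fin order_trans)
  then have "b \<le> card (X - A')" using X by simp
  then obtain x y where "x \<in> A'" "y \<in> X - A'" "E x y"
    using hole[of A' "X - A'"] A' A X by blast
  then show False using edges A' by blast
qed

lemma hole_isolated:
  assumes "X \<subseteq> V" "a + b \<le> card X" "A \<subseteq> X" "a \<le> card A"
    and "\<And>x y. x \<in> A \<Longrightarrow> y \<in> X \<Longrightarrow> \<not> E x y"
  shows False
  using hole_between[of X "{}" A] assms by simp

section \<open>The triangle-free case\<close>

lemma independent_card:
  assumes "I \<subseteq> V" "\<And>x y. x \<in> I \<Longrightarrow> y \<in> I \<Longrightarrow> \<not> E x y"
  shows "card I < a + b"
  using hole_isolated[of I I] assms a_pos by force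

text \<open>Without triangles every neighbourhood is independent and so has exactly
  \<open>a + b - 1\<close> vertices. With \<open>I\<close> one such neighbourhood,
  \<open>V - I\<close> turns out to be independent as well, and counting then joins each vertex of
  \<open>I\<close> to all of \<open>V - I\<close>.\<close>

lemma triangle_or_bipartite:
  assumes "V \<noteq> {}"
  shows "(\<exists>x y z. E x y \<and> E y z \<and> E x z) \<or> is_balanced_complete_bipartite V E"
proof (rule disjCI)
  assume "\<not> is_balanced_complete_bipartite V E"
  show "\<exists>x y z. E x y \<and> E y z \<and> E x z"
  proof (rule ccontr)
    assume "\<not> ?thesis"
    then have tri: "E x y \<Longrightarrow> E y z \<Longrightarrow> \<not> E x z" for x y z by blast
    have nb: "card {u. E v u} = a + b - 1" if "v \<in> V" for v
    proof -
      have "card {u. E v u} < a + b"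
        by (rule independent_card) (use edge_in tri in blast)+
      then show ?thesis using min_deg[OF that] by linarith
    qed
    obtain v where "v \<in> V" using assms by blast
    define I where "I = {u. E v u}"
    have I: "I \<subseteq> V" "card I = a + b - 1" "finite I"
      using edge_in nb[OF \<open>v \<in> V\<close>] by (auto simp: I_def)
    have indep: "x \<in> I \<Longrightarrow> y \<in> I \<Longrightarrow> \<not> E x y" for x y
      using tri unfolding I_def by blast
    \<comment> \<open>Otherwise \<open>y\<close> has at least \<open>a\<close> non-neighbours in
      \<open>I\<close>, and these are isolated in \<open>insert y I\<close>, a set of
      \<open>a + b\<close> vertices.\<close>
    have many: "b \<le> card {x\<in>I. E y x}" if y: "y \<in> V - I" for y
    proof (rule ccontr)
      assume less: "\<not> ?thesis"
      have "card I = card {x\<in>I. E y x} + card {x\<in>I. \<not> E y x}"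
        using I(3) by (subst card_Un_disjoint[symmetric]) (auto intro: arg_cong[where f=card])
      then have "a \<le> card {x\<in>I. \<not> E y x}" using less I(2) by linarith
      moreover have "a + b \<le> card (insert y I)" using I y a_pos by simp
      ultimately show False
        using hole_isolated[of "insert y I" "{x\<in>I. \<not> E y x}"] I y indep E_sym by blast
    qed
    \<comment> \<open>Adjacent vertices have disjoint neighbourhoods, so two blocks of at least
      \<open>b\<close> vertices would fit into the \<open>a + b - 1\<close> vertices of
      \<open>I\<close>, against \<open>a \<le> b\<close>.\<close>
    have indep': "\<not> E y w" if "y \<in> V - I" "w \<in> V - I" for y w
    proof
      assume "E y w"
      then have disj: "{x\<in>I. E y x} \<inter> {x\<in>I. E w x} = {}" using tri by blast
      have "card {x\<in>I. E y x} + card {x\<in>I. E w x} = card ({x\<in>I. E y x} \<union> {x\<in>I. E w x})"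
        using I(3) disj by (simp add: card_Un_disjoint)
      also have "\<dots> \<le> card I" by (rule card_mono) (use I in auto)
      finally show False using many[OF that(1)] many[OF that(2)] I(2) a_le_b a_pos by linarith
    qed
    have "card (V - I) < a + b" by (rule independent_card) (use indep' in auto)
    have N: "{u. E x u} = V - I" if "x \<in> I" for x
    proof (rule card_seteq)
      show "{u. E x u} \<subseteq> V - I" using indep that edge_in by blast
      show "card (V - I) \<le> card {u. E x u}"
        using nb[of x] that I \<open>card (V - I) < a + b\<close> by (auto simp: subset_iff)
    qed (use fin in simp)
    have "I \<noteq> {}" using I(2) a_pos a_le_b by force
    then have "card I = card (V - I)" using N nb I by (metis ex_in_conv subsetD)
    moreover have "E x y \<longleftrightarrow> x \<in> I \<and> y \<in> V - I \<or> x \<in> V - I \<and> y \<in> I" if "x \<in> V" "y \<in> V" for x y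
      using N indep indep' that E_sym by (metis Diff_iff mem_Collect_eq)
    ultimately have "is_balanced_complete_bipartite V E"
      unfolding is_balanced_complete_bipartite_def
      by (intro exI[of _ I] exI[of _ "V - I"]) (use I(1) in auto)
    then show False using \<open>\<not> is_balanced_complete_bipartite V E\<close> by blast
  qed
qed

section \<open>Gadgets and the cycles they provide\<close>

definition path :: "'a list \<Rightarrow> bool" where
  "path xs \<longleftrightarrow> distinct xs \<and> set xs \<subseteq> V \<and> successively E xs"

definition gadget :: "'a list \<Rightarrow> 'a \<Rightarrow> bool" where
  "gadget vs z \<longleftrightarrow> path vs \<and> 2 \<le> length vs \<and> z \<notin> set vs \<and> E (last vs) (hd vs) \<and> E z (hd vs) \<and> E z (last vs)"

definition has_gadget :: "nat \<Rightarrow> bool" where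
  "has_gadget k \<longleftrightarrow> (\<exists>vs z. length vs = k \<and> gadget vs z)"

lemma successively_rev_E [simp]: "successively E (rev xs) \<longleftrightarrow> successively E xs"
proof -
  have "(\<lambda>x y. E y x) = E" using E_sym by blast
  then have "successively (\<lambda>x y. E y x) xs = successively E xs"
    by (rule arg_cong[where f="\<lambda>P. successively P xs"])
  then show ?thesis unfolding successively_rev .
qed

lemma path_rev [simp]: "path (rev xs) \<longleftrightarrow> path xs"
  unfolding path_def successively_rev_E by simp

lemma path_append: "path (xs @ ys) \<longleftrightarrow>
    path xs \<and> path ys \<and> set xs \<inter> set ys = {} \<and> (xs = [] \<or> ys = [] \<or> E (last xs) (hd ys))"
  by (auto simp: path_def successively_append_iff)

lemma path_Cons: "path (x # ys) \<longleftrightarrow> x \<in> V \<and> x \<notin> set ys \<and> path ys \<and> (ys = [] \<or> E x (hd ys))"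
  by (auto simp: path_def successively_Cons)

lemma path_Nil [simp]: "path []"
  by (simp add: path_def)

lemma gadget_rev: "gadget vs z \<Longrightarrow> gadget (rev vs) z"
  using E_sym by (auto simp: gadget_def hd_rev last_rev)

lemma cycle_of_path:
  assumes "path vs" "3 \<le> length vs" "E (last vs) (hd vs)"
  shows "has_cycle_of_length V E (length vs)"
  unfolding has_cycle_of_length_def using assms
  by (auto simp: path_def successively_conv_nth intro!: exI[of _ vs])

text \<open>The path closes up by itself, or through \<open>z\<close>. For \<open>k = 2\<close> the
  path is a single edge, hence the bound in the second claim.\<close>

lemma has_gadget_cycle:
  assumes "has_gadget k"
  shows "has_cycle_of_length V E (Suc k)" "3 \<le> k \<Longrightarrow> has_cycle_of_length V E k"
proof -
  obtain vs z where vs: "length vs = k" "gadget vs z" using assms by (auto simp: has_gadget_def)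
  show "has_cycle_of_length V E k" if "3 \<le> k"
    using cycle_of_path[of vs] vs that by (simp add: gadget_def)
  have "path (z # vs)" using vs(2) edge_in[of z "hd vs"]
    by (auto simp: gadget_def path_def successively_Cons)
  moreover have "E (last (z # vs)) (hd (z # vs))" using vs E_sym by (auto simp: gadget_def)
  ultimately show "has_cycle_of_length V E (Suc k)"
    using cycle_of_path[of "z # vs"] vs by (auto simp: gadget_def)
qed

end

section \<open>Gadgets that cannot be enlarged\<close>

text \<open>The setting of the proof by contradiction. \<open>no_gadget\<close> ranges over all
  gadgets, so that a larger one built on a different triangle is excluded too.\<close>

locale stuck_gadget = hole_free_graph +
  fixes vs :: "'a list" and z :: 'a
  assumes gadget: "gadget vs z"
    and no_gadget: "gadget us y \<Longrightarrow> length us \<noteq> length vs + 1 \<and> length us \<noteq> length vs + 2"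
begin

abbreviation "k \<equiv> length vs"

definition W :: "'a set" where "W = V - set vs - {z}"

lemma vs_path: "path vs" and k_ge: "2 \<le> k" and z_notin: "z \<notin> set vs"
  and closing: "E (last vs) (hd vs)" and z_hd: "E z (hd vs)" and z_last: "E z (last vs)"
  using gadget by (auto simp: gadget_def)

lemma hd_nth: "hd vs = vs ! 0" and last_nth: "last vs = vs ! (k - 1)"
proof -
  have "vs \<noteq> []" using k_ge by auto
  then show "hd vs = vs ! 0" "last vs = vs ! (k - 1)" by (auto simp: hd_conv_nth last_conv_nth)
qed

text \<open>Lets every fact about one end of the path be transferred to the other end.\<close>

lemma rev_stuck: "stuck_gadget V E a b (rev vs) z"
  by unfold_locales (use gadget_rev[OF gadget] no_gadget in auto)

section \<open>Rerouting the path\<close>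

definition splits :: "nat \<Rightarrow> nat \<Rightarrow> 'a list \<Rightarrow> 'a list \<Rightarrow> 'a list \<Rightarrow> bool" where
  "splits p q xs ms ys \<longleftrightarrow> vs = xs @ ms @ ys \<and> length xs = p \<and> p + length ms = q \<and> 1 \<le> p"

lemma split_at:
  assumes "1 \<le> p" "p \<le> q" "q \<le> k"
  obtains xs ms ys where "splits p q xs ms ys"
proof
  show "splits p q (take p vs) (drop p (take q vs)) (drop q vs)"
    using assms unfolding splits_def
    by (auto simp flip: append_assoc) (metis append_take_drop_id min.absorb1 take_take)
qed

lemma splitsD:
  assumes "splits p q xs ms ys"
  shows "k = q + length ys" "length xs = p" "length ms = q - p"
    "xs \<noteq> []" "hd xs = hd vs" "last xs = vs ! (p - 1)"
    "p < q \<Longrightarrow> ms \<noteq> [] \<and> hd ms = vs ! p \<and> last ms = vs ! (q - 1)"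
    "q < k \<Longrightarrow> ys \<noteq> [] \<and> hd ys = vs ! q \<and> last ys = last vs"
    "path xs" "path ms" "path ys"
    "set xs \<inter> set ms = {}" "set xs \<inter> set ys = {}" "set ms \<inter> set ys = {}"
    "set vs = set xs \<union> set ms \<union> set ys"
proof -
  have s: "vs = xs @ ms @ ys" "length xs = p" "p + length ms = q" "1 \<le> p"
    using assms by (auto simp: splits_def)
  then show "length xs = p" "length ms = q - p" "xs \<noteq> []" by auto
  show "k = q + length ys" "hd xs = hd vs" "set vs = set xs \<union> set ms \<union> set ys"
    unfolding s(1) using s(2-4) \<open>xs \<noteq> []\<close> by auto
  show "last xs = vs ! (p - 1)"
    unfolding s(1) using s(2-4) \<open>xs \<noteq> []\<close> by (simp add: last_conv_nth nth_append)
  show "ms \<noteq> [] \<and> hd ms = vs ! p \<and> last ms = vs ! (q - 1)" if "p < q"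
  proof -
    have ms: "ms \<noteq> []" using s that by auto
    then have "q - 1 = length xs + (length ms - 1)" using s(2,3) by (cases ms) auto
    then have "last ms = vs ! (q - 1)"
      unfolding s(1) using ms by (simp add: last_conv_nth nth_append)
    moreover have "hd ms = vs ! p"
      unfolding s(1) using s(2) ms by (simp add: hd_conv_nth nth_append)
    ultimately show ?thesis using ms by simp
  qed
  show "ys \<noteq> [] \<and> hd ys = vs ! q \<and> last ys = last vs" if "q < k"
    using that unfolding s(1) using s(2-4) by (auto simp: hd_conv_nth nth_append)
  have "path (xs @ ms @ ys)" using s(1) vs_path by simp
  then show "path xs" "path ms" "path ys"
    "set xs \<inter> set ms = {}" "set xs \<inter> set ys = {}" "set ms \<inter> set ys = {}"
    by (auto simp: path_append)
qed

text \<open>The \<open>j - i - 1\<close> vertices strictly between positions \<open>i\<close> and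
  \<open>j\<close> are replaced by \<open>ws\<close>. Both ends of the path stay, so the triangle
  survives, and the excluded lengths are those giving order \<open>k + 1\<close> or
  \<open>k + 2\<close>.\<close>

lemma detour:
  assumes ij: "i < j" "j < k" and ws: "path ws" "set ws \<subseteq> W" "ws \<noteq> []"
    and e: "E (vs ! i) (hd ws)" "E (last ws) (vs ! j)"
  shows "length ws \<noteq> j - i \<and> length ws \<noteq> Suc (j - i)"
proof -
  have le: "1 \<le> Suc i" "Suc i \<le> j" "j \<le> k" using ij by auto
  obtain xs ms ys where "splits (Suc i) j xs ms ys" by (rule split_at[OF le])
  note s0 = splitsD[OF this]
  have s: "k = j + length ys" "length xs = Suc i" "length ms = j - Suc i"
    "xs \<noteq> []" "hd xs = hd vs" "last xs = vs ! i" "ys \<noteq> [] \<and> hd ys = vs ! j \<and> last ys = last vs"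
    "path xs" "path ys" "set xs \<inter> set ys = {}" "set vs = set xs \<union> set ms \<union> set ys"
    using s0 ij by auto
  have disj: "set ws \<inter> set xs = {}" "set ws \<inter> set ys = {}" "z \<notin> set ws"
    using ws(2) s(11) by (auto simp: W_def)
  then have "path (xs @ ws @ ys)"
    using s ws e by (auto simp: path_append)
  moreover have "z \<notin> set (xs @ ws @ ys)"
    using disj s(11) z_notin by simp
  ultimately have "gadget (xs @ ws @ ys) z"
    using closing z_hd z_last s ij ws by (simp add: gadget_def Suc_le_eq)
  then show ?thesis using no_gadget[of "xs @ ws @ ys" z] s(1,2) ij by auto
qed

text \<open>The new path runs up to position \<open>p - 1\<close>, jumps to \<open>q - 1\<close>,
  goes backwards to \<open>p\<close>, and passes through \<open>ws\<close> to \<open>q\<close>. It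
  loses no vertex and gains those of \<open>ws\<close>.\<close>

lemma cross:
  assumes pq: "1 \<le> p" "p < q" "q < k" and ws: "path ws" "set ws \<subseteq> W" "length ws = 1 \<or> length ws = 2"
    and e: "E (vs ! p) (hd ws)" "E (last ws) (vs ! q)"
  shows "\<not> E (vs ! (p - 1)) (vs ! (q - 1))"
proof
  assume e': "E (vs ! (p - 1)) (vs ! (q - 1))"
  have le: "1 \<le> p" "p \<le> q" "q \<le> k" using pq by auto
  obtain xs ms ys where "splits p q xs ms ys" by (rule split_at[OF le])
  note s0 = splitsD[OF this]
  note s = s0(1-6) s0(7)[OF pq(2)] s0(8)[OF pq(3)] s0(9-15)
  let ?us = "xs @ rev ms @ ws @ ys"
  have "ws \<noteq> []" using ws(3) by auto
  have disj: "set ws \<inter> set xs = {}" "set ws \<inter> set ms = {}" "set ws \<inter> set ys = {}" "z \<notin> set ws"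
    using ws(2) s(15) by (auto simp: W_def)
  then have "path ?us"
    using s ws(1) e e' \<open>ws \<noteq> []\<close> by (auto simp: path_append hd_rev last_rev)
  moreover have "z \<notin> set ?us"
    using disj s(15) z_notin by simp
  moreover have len: "length ?us = k + length ws"
    using s(1-3) pq by simp
  ultimately have "gadget ?us z"
    using closing z_hd z_last s k_ge by (simp add: gadget_def)
  then show False using no_gadget[of ?us z] len ws(3) by auto
qed

text \<open>The new gadget uses the same triangle, but its cycle passes through the edge between
  \<open>hd vs\<close> and \<open>z\<close>, and its outside vertex is \<open>last vs\<close>.\<close>

lemma tail_gadget:
  assumes us: "path us" "us \<noteq> []" "hd us = hd vs" "set us \<subseteq> set vs - {last vs}"
    and ws: "path ws" "set ws \<subseteq> W" "ws \<noteq> []" "E (last ws) z" "E (last us) (hd ws)"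
  shows "length us + length ws \<noteq> k \<and> length us + length ws \<noteq> Suc k"
proof -
  let ?us = "us @ ws @ [z]"
  have last_in: "last vs \<in> set vs" using k_ge by (intro last_in_set) auto
  have "z \<in> V" using edge_in[OF z_hd] by simp
  then have "path [z]" by (simp add: path_def)
  moreover have disj: "set us \<inter> set ws = {}" "z \<notin> set us" "z \<notin> set ws" "last vs \<notin> set ws" "last vs \<noteq> z"
    using us(4) ws(2) z_notin last_in unfolding W_def by blast+
  ultimately have "path ?us"
    using us ws by (simp add: path_append)
  moreover have "E z (hd vs)" "E (last vs) (hd vs)" "E (last vs) z"
    using z_hd closing z_last sym by blast+
  moreover have "2 \<le> length ?us" "last vs \<notin> set ?us" "hd ?us = hd vs" "last ?us = z"
    using us disj by (auto simp: Suc_le_eq)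
  ultimately have "gadget ?us (last vs)"
    unfolding gadget_def by simp
  then show ?thesis using no_gadget[of ?us "last vs"] by auto
qed

text \<open>Only the first \<open>q\<close> path vertices are kept, followed by \<open>ws\<close>
  and \<open>z\<close>. In the second claim they are first rearranged by a crossing edge so that
  they end at position \<open>p\<close>.\<close>

lemma tail:
  assumes q: "1 \<le> q" "q < k"
    and ws: "path ws" "set ws \<subseteq> W" "ws \<noteq> []" "E (last ws) z" "q + length ws = k \<or> q + length ws = Suc k"
  shows "\<not> E (vs ! (q - 1)) (hd ws)"
    and "1 \<le> p \<Longrightarrow> p < q \<Longrightarrow> E (vs ! p) (hd ws) \<Longrightarrow> \<not> E (vs ! (p - 1)) (vs ! (q - 1))"
proof -
  show "\<not> E (vs ! (q - 1)) (hd ws)"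
  proof
    assume e: "E (vs ! (q - 1)) (hd ws)"
    have le: "1 \<le> q" "q \<le> q" "q \<le> k" using q by auto
    obtain xs ms ys where "splits q q xs ms ys" by (rule split_at[OF le])
    note s0 = splitsD[OF this]
    note s = s0(1-6) s0(8)[OF q(2)] s0(9-15)
    have lst: "last vs \<notin> set xs" using s by (metis disjoint_iff last_in_set)
    show False
      using tail_gadget[of xs ws] ws e lst s by auto
  qed
  show "\<not> E (vs ! (p - 1)) (vs ! (q - 1))" if p: "1 \<le> p" "p < q" "E (vs ! p) (hd ws)"
  proof
    assume e: "E (vs ! (p - 1)) (vs ! (q - 1))"
    have le: "1 \<le> p" "p \<le> q" "q \<le> k" using p q by auto
    obtain xs ms ys where "splits p q xs ms ys" by (rule split_at[OF le])
    note s0 = splitsD[OF this]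
    note s = s0(1-6) s0(7)[OF p(2)] s0(8)[OF q(2)] s0(9-15)
    have "path (xs @ rev ms)" using s e by (auto simp: path_append hd_rev)
    moreover have "last vs \<notin> set (xs @ rev ms)" using s by (simp, metis disjoint_iff last_in_set)
    ultimately show False
      using tail_gadget[of "xs @ rev ms" ws] ws p s by (auto simp: last_rev)
  qed
qed

lemma path1: "w \<in> V \<Longrightarrow> path [w]" and path2: "E u w \<Longrightarrow> path [u, w]"
  using edge_in irrefl by (auto simp: path_def)

lemma W_props: "w \<in> W \<Longrightarrow> w \<in> V \<and> w \<notin> set vs \<and> w \<noteq> z"
  by (auto simp: W_def)

lemma finite_W [simp]: "finite W"
  using fin by (simp add: W_def)

text \<open>Otherwise \<open>w\<close>, \<open>z\<close> and \<open>last vs\<close> form a triangle,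
  and \<open>z # vs\<close> with outside vertex \<open>w\<close> is a gadget of order
  \<open>k + 1\<close>.\<close>

lemma nbr_z_not_last:
  assumes "w \<in> W" "E w z"
  shows "\<not> E w (last vs)"
proof
  assume "E w (last vs)"
  have "path (z # vs)" using vs_path z_notin z_hd edge_in[OF z_hd] by (auto simp: path_def successively_Cons)
  moreover have "vs \<noteq> []" "E (last vs) z" using k_ge z_last sym by auto
  ultimately have "gadget (z # vs) w"
    using k_ge assms W_props[of w] \<open>E w (last vs)\<close> by (simp add: gadget_def)
  then show False using no_gadget[of "z # vs"] by simp
qed

lemma nbr_z_not_hd:
  assumes "w \<in> W" "E w z"
  shows "\<not> E w (hd vs)"
proof -
  interpret R: stuck_gadget V E a b "rev vs" z by (rule rev_stuck)
  have "R.W = W" by (simp add: W_def R.W_def)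
  then show ?thesis using R.nbr_z_not_last[of w] assms by (simp add: last_rev)
qed

text \<open>Otherwise \<open>z\<close> can be inserted just before \<open>last vs\<close>, while
  \<open>w\<close> takes over as the outside vertex.\<close>

lemma apex_not_penultimate:
  assumes "w \<in> W" "E w (hd vs)" "E w (last vs)"
  shows "\<not> E z (vs ! (k - 2))"
proof
  assume e: "E z (vs ! (k - 2))"
  have le: "1 \<le> k - 1" "k - 1 \<le> k - 1" "k - 1 \<le> k" using k_ge by auto
  obtain xs ms ys where "splits (k - 1) (k - 1) xs ms ys" by (rule split_at[OF le])
  note s0 = splitsD[OF this]
  have ys: "ys \<noteq> []" "hd ys = last vs" "last ys = last vs" using s0(8) k_ge last_nth by auto
  have "last xs = vs ! (k - 2)" using s0(6) by (simp add: numeral_2_eq_2)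
  then have "path (xs @ [z] @ ys)"
    using s0(4,9,11,13,15) ys e z_notin z_last sym edge_in[OF z_hd] by (simp add: path_append path_Cons)
  then have "gadget (xs @ [z] @ ys) w"
    using s0(2,4,5,15) ys assms W_props[of w] closing k_ge by (simp add: gadget_def)
  then show False using no_gadget[of "xs @ [z] @ ys"] s0(1,2) k_ge by auto
qed

text \<open>Otherwise \<open>z\<close>, \<open>vs ! (p - 1)\<close> and \<open>last vs\<close> form
  a triangle. The path from \<open>vs ! (p - 1)\<close> back to \<open>hd vs\<close>, through
  \<open>w\<close> to \<open>vs ! p\<close> and on to \<open>last vs\<close> has
  \<open>k + 1\<close> vertices.\<close>

lemma apex_pred_not_last:
  assumes "w \<in> W" "E w (hd vs)" "1 \<le> p" "p < k" "E w (vs ! p)" "E z (vs ! (p - 1))"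
  shows "\<not> E (last vs) (vs ! (p - 1))"
proof
  assume e: "E (last vs) (vs ! (p - 1))"
  have le: "1 \<le> p" "p \<le> p" "p \<le> k" using assms by auto
  obtain xs ms ys where "splits p p xs ms ys" by (rule split_at[OF le])
  note s0 = splitsD[OF this]
  have ys: "ys \<noteq> []" "hd ys = vs ! p" "last ys = last vs" using s0(8) assms by auto
  let ?us = "rev xs @ [w] @ ys"
  have "path ?us"
    using s0(4,5,9,11,13,15) ys assms W_props[of w] sym by (simp add: path_append path_Cons last_rev)
  moreover have "hd ?us = vs ! (p - 1)" "last ?us = last vs" "z \<notin> set ?us" "length ?us = k + 1"
    using s0(1,2,4,6,15) ys z_notin W_props[of w] assms(1) by (auto simp: hd_rev)
  ultimately have "gadget ?us z"
    using assms e z_last k_ge by (simp add: gadget_def)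
  then show False using no_gadget[of ?us] \<open>length ?us = k + 1\<close> by auto
qed

section \<open>Degrees inside \<open>W\<close>\<close>

definition idx :: "'a \<Rightarrow> nat set" where
  "idx w = {p. p < k \<and> E w (vs ! p)}"

text \<open>Predecessors on \<open>vs\<close> of neighbours; index 0 is left out because it has no predecessor.\<close>

definition preds :: "'a \<Rightarrow> 'a set" where
  "preds w = (\<lambda>p. vs ! (p - 1)) ` (idx w - {0})"

abbreviation nbrs :: "'a \<Rightarrow> 'a set" where
  "nbrs w \<equiv> {u \<in> W. E w u}"

lemma finite_idx [simp]: "finite (idx w)"
  by (rule finite_subset[of _ "{..<k}"]) (auto simp: idx_def)

lemma vs_distinct: "distinct vs" and vs_V: "set vs \<subseteq> V" and z_V: "z \<in> V"
  using vs_path edge_in[OF z_hd] by (auto simp: path_def)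

lemma nth_V: "p < k \<Longrightarrow> vs ! p \<in> V"
  using vs_V nth_mem by blast

lemma card_degree: "card {u. E w u} = card (idx w) + (if E w z then 1 else 0) + card (nbrs w)"
proof -
  have "{u. E w u} = (nth vs ` idx w \<union> (if E w z then {z} else {})) \<union> nbrs w"
    using edge_in by (auto simp: idx_def W_def in_set_conv_nth)
  moreover have "(nth vs ` idx w \<union> (if E w z then {z} else {})) \<inter> nbrs w = {}"
    by (auto simp: idx_def W_def)
  moreover have "nth vs ` idx w \<inter> (if E w z then {z} else {}) = {}"
    using z_notin by (auto simp: idx_def)
  moreover have "card (nth vs ` idx w) = card (idx w)"
    by (rule card_image) (use vs_distinct in \<open>auto simp: inj_on_def idx_def nth_eq_iff_index_eq\<close>)
  ultimately show ?thesis
    by (simp add: card_Un_disjoint)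
qed

lemma min_deg': "w \<in> V \<Longrightarrow> a + b \<le> Suc (card (idx w) + (if E w z then 1 else 0) + card (nbrs w))"
  using min_deg[of w] card_degree[of w] by simp

lemma min_deg_le: "w \<in> V \<Longrightarrow> a + b \<le> card (idx w) + card (nbrs w) + 2"
  using min_deg'[of w] by (auto split: if_splits)

lemma preds_vs: "preds w \<subseteq> set vs"
  by (auto simp: preds_def idx_def)

lemma predsE:
  assumes "x \<in> preds w"
  obtains p where "p \<in> idx w" "0 < p" "x = vs ! (p - 1)"
proof -
  obtain p where "p \<in> idx w - {0}" "x = vs ! (p - 1)" using assms unfolding preds_def by (rule imageE)
  then show ?thesis by (intro that[of p]) auto
qed

lemma card_preds: "card (preds w) = card (idx w - {0})"
  unfolding preds_def
  by (rule card_image) (use vs_distinct in \<open>auto simp: inj_on_def idx_def nth_eq_iff_index_eq\<close>)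

lemma idx_not_consecutive: "w \<in> W \<Longrightarrow> p \<in> idx w \<Longrightarrow> Suc p \<notin> idx w"
  using detour[of p "Suc p" "[w]"] path1[of w] W_props[of w] E_sym by (auto simp: idx_def)

lemma preds_not_adj: "w \<in> W \<Longrightarrow> x \<in> preds w \<Longrightarrow> \<not> E w x"
proof
  assume w: "w \<in> W" and "x \<in> preds w" and e: "E w x"
  from this(2) obtain p where p: "p \<in> idx w" "0 < p" "x = vs ! (p - 1)" by (rule predsE)
  then have "p - 1 \<in> idx w" using e by (auto simp: idx_def)
  then show False using idx_not_consecutive[OF w, of "p - 1"] p by simp
qed

lemma preds_independent:
  assumes "w \<in> W" "x \<in> preds w" "y \<in> preds w"
  shows "\<not> E x y"
proof -
  have *: "\<not> E (vs ! (p - 1)) (vs ! (q - 1))" if "p \<in> idx w - {0}" "q \<in> idx w - {0}" "p < q" for p q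
    using cross[of p q "[w]"] that path1[of w] W_props[of w] assms(1) E_sym by (auto simp: idx_def)
  obtain p q where "p \<in> idx w - {0}" "x = vs ! (p - 1)" "q \<in> idx w - {0}" "y = vs ! (q - 1)"
    using assms unfolding preds_def by blast
  then show ?thesis using *[of p q] *[of q p] irrefl E_sym by (metis nat_neq_iff)
qed

lemma preds_not_adj_nbrs:
  assumes "w \<in> W" "x \<in> preds w" "u \<in> nbrs w"
  shows "\<not> E u x"
proof -
  obtain p where p: "p \<in> idx w" "0 < p" "x = vs ! (p - 1)" using assms(2) by (rule predsE)
  show ?thesis
    using detour[of "p - 1" p "[u, w]"] p assms path2[of u w] E_sym[of x u] E_sym[of u w] E_sym[of w "vs ! p"]
    by (auto simp: idx_def)
qed

text \<open>Collects the three preceding facts in the form in which the hole condition uses them: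
  the predecessors are isolated in a set of nearly \<open>a + b\<close> vertices or more.\<close>

lemma preds_isolated:
  assumes "w \<in> W" "x \<in> preds w" "y \<in> preds w \<union> insert w (nbrs w)"
  shows "\<not> E x y"
  using assms preds_not_adj[of w x] preds_independent[of w x y] preds_not_adj_nbrs[of w x y] sym by blast

lemma card_preds_Un:
  assumes "w \<in> W"
  shows "card (preds w \<union> insert w (nbrs w)) = card (preds w) + Suc (card (nbrs w))"
proof -
  have "preds w \<inter> insert w (nbrs w) = {}"
    using preds_vs[of w] assms by (auto simp: W_def)
  then show ?thesis
    using irrefl by (subst card_Un_disjoint) (auto simp: preds_def)
qed

lemma preds_Un_V: "w \<in> W \<Longrightarrow> preds w \<union> insert w (nbrs w) \<subseteq> V"
  using preds_vs[of w] vs_V W_props by blast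

text \<open>The case without loss: each neighbour of \<open>w\<close> other than those in
  \<open>W\<close> lies on the path and has a predecessor, so the set reaches size
  \<open>a + b\<close>. Fewer than \<open>b\<close> neighbours in \<open>W\<close> would mean at
  least \<open>a\<close> predecessors.\<close>

lemma nbrs_large_if_not_hd:
  assumes w: "w \<in> W" and "\<not> E w z" "\<not> E w (hd vs)"
  shows "b \<le> card (nbrs w)"
proof (rule ccontr)
  assume less: "\<not> ?thesis"
  have "idx w - {0} = idx w" using assms hd_nth by (auto simp: idx_def)
  then have c: "card (preds w) = card (idx w)" by (simp add: card_preds)
  have d: "a + b \<le> Suc (card (idx w) + card (nbrs w))"
    using min_deg'[of w] assms W_props[OF w] by simp
  show False
    by (rule hole_isolated[OF preds_Un_V[OF w], of "preds w"])
      (use card_preds_Un[OF w] c d less preds_isolated[OF w] in auto)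
qed

lemma nbrs_large_if_adj_z:
  assumes w: "w \<in> W" and wz: "E w z"
  shows "b \<le> card (nbrs w)"
proof (rule ccontr)
  assume less: "\<not> ?thesis"
  have ends: "\<not> E w (hd vs)" "\<not> E w (last vs)" using nbr_z_not_hd nbr_z_not_last assms by auto
  then have "idx w - {0} = idx w" "k - 1 \<notin> idx w" using hd_nth last_nth by (auto simp: idx_def)
  then have c: "card (preds w) = card (idx w)" by (simp add: card_preds)
  have d: "a + b \<le> Suc (card (idx w) + 1 + card (nbrs w))"
    using min_deg'[of w] wz W_props[OF w] by simp
  \<comment> \<open>The neighbour \<open>z\<close> of \<open>w\<close> has no predecessor, so one
    vertex is missing. The penultimate path vertex supplies it: \<open>tail\<close> with
    \<open>q = k - 1\<close> and \<open>ws\<close> equal to \<open>[w]\<close> or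
    \<open>[u, w]\<close> makes it isolated too.\<close>
  define e where "e = vs ! (k - 2)"
  have pen: "k - 2 = k - 1 - 1" by simp
  have eV: "e \<in> V" "e \<in> set vs" using nth_V k_ge by (auto simp: e_def)
  have tl: "1 \<le> k - 1" "k - 1 < k" using k_ge by auto
  have k_eq: "k - 1 + 1 = k" using k_ge by linarith
  have ws: "path [w]" "set [w] \<subseteq> W" "[w] \<noteq> []" "E (last [w]) z"
    "k - 1 + length [w] = k \<or> k - 1 + length [w] = Suc k"
    using path1[of w] W_props[OF w] w wz k_eq by auto
  have ew: "\<not> E e w" using tail(1)[OF tl ws] by (simp add: e_def pen)
  have eu: "\<not> E e u" if "u \<in> nbrs w" for u
  proof -
    have "path [u, w]" "set [u, w] \<subseteq> W" "[u, w] \<noteq> []" "E (last [u, w]) z"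
      "k - 1 + length [u, w] = k \<or> k - 1 + length [u, w] = Suc k"
      using path2[of u w] that w wz sym k_eq by auto
    from tail(1)[OF tl this] show ?thesis by (simp add: e_def pen)
  qed
  have ep: "\<not> E e x" if x: "x \<in> preds w" for x
  proof -
    obtain p where p: "p \<in> idx w" "0 < p" "x = vs ! (p - 1)" using x by (rule predsE)
    have "p < k" "p \<noteq> k - 1" using p \<open>k - 1 \<notin> idx w\<close> by (auto simp: idx_def)
    then have "p < k - 1" by linarith
    moreover have "E (vs ! p) (hd [w])" using p sym by (simp add: idx_def)
    ultimately have "\<not> E (vs ! (p - 1)) (vs ! (k - 1 - 1))" using tail(2)[OF tl ws, of p] p by simp
    then show ?thesis using p sym by (auto simp: e_def pen)
  qed
  have "e \<notin> preds w"
  proof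
    assume "e \<in> preds w"
    then obtain p where p: "p \<in> idx w" "0 < p" "vs ! (k - 2) = vs ! (p - 1)"
      unfolding e_def by (rule predsE)
    then have "p - 1 = k - 2"
      using vs_distinct k_ge by (subst (asm) nth_eq_iff_index_eq) (auto simp: idx_def)
    then have "p = k - 1" using p(2) k_ge by linarith
    then show False using p \<open>k - 1 \<notin> idx w\<close> by simp
  qed
  moreover have "e \<notin> insert w (nbrs w)" using eV w by (auto simp: W_def)
  ultimately have "card (insert e (preds w \<union> insert w (nbrs w))) = Suc (card (preds w) + Suc (card (nbrs w)))"
    using card_preds_Un[OF w] by (subst card_insert_disjoint) (auto simp: preds_def)
  moreover have "card (insert e (preds w)) = Suc (card (preds w))"
    using \<open>e \<notin> preds w\<close> by (simp add: preds_def)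
  moreover have "insert e (preds w \<union> insert w (nbrs w)) \<subseteq> V" using preds_Un_V[OF w] eV by blast
  moreover have "\<not> E x y" if "x \<in> insert e (preds w)" "y \<in> insert e (preds w \<union> insert w (nbrs w))" for x y
    using that ew eu ep irrefl sym preds_isolated[OF w] by blast
  ultimately show False
    using hole_isolated[of "insert e (preds w \<union> insert w (nbrs w))" "insert e (preds w)"] c d less by auto
qed

text \<open>Position 0 has no predecessor, so \<open>X\<close> may be one vertex short of
  \<open>a + b\<close>. The vertex to be added is \<open>last vs\<close>, \<open>z\<close> or
  \<open>vs ! (k - 3)\<close>, depending on how \<open>z\<close> is joined to the predecessors and
  to the neighbours of \<open>w\<close> in \<open>W\<close>.\<close>

lemma nbrs_large_if_adj_ends:
  assumes w: "w \<in> W" and "\<not> E w z" and ends: "E w (hd vs)" "E w (last vs)"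
  shows "b \<le> card (nbrs w)"
proof (rule ccontr)
  assume less: "\<not> ?thesis"
  define X where "X = preds w \<union> insert w (nbrs w)"
  have in_idx: "0 \<in> idx w" "k - 1 \<in> idx w" using ends hd_nth last_nth k_ge by (auto simp: idx_def)
  have k3: "3 \<le> k"
  proof (rule ccontr)
    assume "\<not> ?thesis"
    then have "k - 1 = Suc 0" using k_ge by simp
    then show False using in_idx idx_not_consecutive[OF w, of 0] by simp
  qed
  have no_pen: "k - 2 \<notin> idx w"
  proof -
    have "Suc (k - 2) = k - 1" using k3 by linarith
    then show ?thesis using idx_not_consecutive[OF w, of "k - 2"] in_idx by auto
  qed
  have c: "card (idx w) = Suc (card (preds w))"
    using in_idx card_preds[of w] card_gt_0_iff[of "idx w"] by auto
  have d: "a + b \<le> Suc (card (idx w) + card (nbrs w))"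
    using min_deg'[of w] assms W_props[OF w] by simp
  have fin_preds: "finite (preds w)" by (simp add: preds_def)
  have fin_X: "finite X" using fin_preds by (simp add: X_def)
  have X_V: "X \<subseteq> V" using preds_Un_V[OF w] by (simp add: X_def)
  have preds_X: "preds w \<subseteq> X" by (auto simp: X_def)
  have iso: "\<not> E x y" if "x \<in> preds w" "y \<in> X" for x y
    using preds_isolated[OF w that(1)] that(2) by (simp add: X_def)
  have iso': "\<not> E y x" if "x \<in> preds w" "y \<in> X" for x y
    using iso[OF that] sym by blast
  have X_large: "a + b \<le> card (insert x X)" if "x \<notin> X" for x
  proof -
    have "card (insert x X) = Suc (card X)" by (rule card_insert_disjoint[OF fin_X that])
    then show ?thesis using card_preds_Un[OF w, folded X_def] c d by linarith
  qed
  have not_pred: "vs ! i \<notin> preds w" if "i < k" "Suc i \<notin> idx w" for i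
  proof
    assume "vs ! i \<in> preds w"
    then obtain p where p: "p \<in> idx w" "0 < p" "vs ! i = vs ! (p - 1)" by (rule predsE)
    then have "i = p - 1"
      using vs_distinct that by (subst (asm) nth_eq_iff_index_eq) (auto simp: idx_def)
    then show False using p that by simp
  qed
  define q where "q = vs ! (k - 2)"
  have "q = vs ! (k - 1 - 1)" "k - 1 \<in> idx w - {0}" using in_idx k3 by (auto simp: q_def numeral_2_eq_2)
  then have q: "q \<in> preds w" unfolding preds_def by (rule image_eqI)
  have z_notin_X: "z \<notin> X" using preds_vs[of w] z_notin w by (auto simp: W_def X_def)
  have z_X_V: "insert z X \<subseteq> V" using X_V z_V by blast
  show False
  proof (cases "\<exists>u\<in>nbrs w. E u z")
    case False
    define T where "T = {x \<in> preds w. E z x}"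
    show False
    proof (cases "a \<le> card T")
      \<comment> \<open>Many predecessors are adjacent to \<open>z\<close>: by
        \<open>apex_pred_not_last\<close> none of them is adjacent to \<open>last vs\<close>, which
        can be added.\<close>
      case True
      have l: "last vs \<in> set vs" using k_ge by (intro last_in_set) auto
      have "k - 1 < k" "Suc (k - 1) = k" using k_ge by linarith+
      then have "last vs \<notin> preds w" using not_pred[of "k - 1"] by (simp add: last_nth idx_def)
      then have l_notin: "last vs \<notin> X" using l w by (auto simp: W_def X_def)
      have "\<not> E x (last vs)" if "x \<in> T" for x
      proof -
        have "x \<in> preds w" using \<open>x \<in> T\<close> by (simp add: T_def)
        then obtain p where "p \<in> idx w" "0 < p" "x = vs ! (p - 1)" by (rule predsE)
        then show ?thesis
          using apex_pred_not_last[OF w ends(1), of p] \<open>x \<in> T\<close> sym by (auto simp: idx_def T_def)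
      qed
      then have "\<not> E x y" if "x \<in> T" "y \<in> insert (last vs) X" for x y
        using that iso[of x y] unfolding T_def by blast
      moreover have "T \<subseteq> insert (last vs) X" "insert (last vs) X \<subseteq> V"
        using preds_X X_V l vs_V by (auto simp: T_def)
      ultimately show False
        using hole_isolated[of "insert (last vs) X" T] True X_large[OF l_notin] by blast
    next
      \<comment> \<open>Few predecessors are adjacent to \<open>z\<close>: now \<open>z\<close> is
        added, put on the same side as its neighbours \<open>T\<close>, and the other predecessors
        fill that side up to \<open>a\<close>.\<close>
      case small: False
      have "finite T" using fin_preds by (simp add: T_def)
      then have 1: "card (insert z T) \<le> a" using small by (simp add: card_insert_if)
      have "z \<notin> preds w" using z_notin_X preds_X by blast
      then have 2: "a \<le> card (insert z (preds w))" using fin_preds c d less by simp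
      have zX: "\<not> E z y" if y: "y \<in> X - T" for y
      proof
        assume e: "E z y"
        then have "y \<notin> preds w" using y by (simp add: T_def)
        then have "y = w \<or> y \<in> nbrs w" using y by (auto simp: X_def)
        then show False using sym[OF e] False \<open>\<not> E w z\<close> by blast
      qed
      have 3: "\<not> E x y" if "x \<in> insert z T" "y \<in> insert z X - insert z T" for x y
        using that iso[of x y] zX[of y] by (auto simp: T_def)
      have 4: "\<not> E x y" if "x \<in> insert z (preds w) - insert z T" "y \<in> insert z X" for x y
        using that iso[of x y] E_sym[of x z] by (auto simp: T_def)
      have 5: "insert z T \<subseteq> insert z (preds w)" "insert z (preds w) \<subseteq> insert z X"
        using preds_X by (auto simp: T_def)
      show False
        by (rule hole_between[OF z_X_V X_large[OF z_notin_X] 5 1 2 3 4])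
    qed
  next
    case True
    then obtain u where u: "u \<in> W" "E w u" "E u z" by blast
    show False
    proof (cases "a = 1")
      case True
      \<comment> \<open>With \<open>a = 1\<close> a single isolated vertex suffices, and
        \<open>q\<close>, the predecessor of \<open>last vs\<close>, remains isolated after adding
        \<open>z\<close>.\<close>
      have "\<not> E q z" using apex_not_penultimate[OF w ends] sym by (auto simp: q_def)
      then have "\<not> E q y" if "y \<in> insert z X" for y
        using that iso[OF q, of y] by blast
      moreover have "{q} \<subseteq> insert z X" "a \<le> card {q}" using q preds_X True by auto
      ultimately show False
        using hole_isolated[OF z_X_V X_large[OF z_notin_X], of "{q}"] by blast
    next
      case False
      \<comment> \<open>Within \<open>insert e X\<close> the only possible neighbour of
        \<open>e\<close> is \<open>q\<close>. Placing both on the side of size \<open>a\<close> is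
        possible because now \<open>2 \<le> a\<close>.\<close>
      define e where "e = vs ! (k - 3)"
      have pen: "vs ! (k - 2 - 1) = e" by (simp add: e_def)
      have e: "e \<in> V" "e \<in> set vs" using nth_V k3 by (auto simp: e_def)
      have tl: "1 \<le> k - 2" "k - 2 < k" using k3 by auto
      have "Suc (k - 3) = k - 2" using k3 by linarith
      then have "Suc (k - 3) \<notin> idx w" using no_pen by simp
      then have "e \<notin> preds w" using not_pred[of "k - 3"] k3 by (simp add: e_def)
      then have e_notin: "e \<notin> X" using e w by (auto simp: W_def X_def)
      have ws: "path [w, u]" "set [w, u] \<subseteq> W" "[w, u] \<noteq> []" "E (last [w, u]) z"
        "k - 2 + length [w, u] = k \<or> k - 2 + length [w, u] = Suc k"
        using path2[OF u(2)] u w k3 by auto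
      have ew: "\<not> E e w" using tail(1)[OF tl ws, unfolded pen] by simp
      have eu: "\<not> E e v" if "v \<in> nbrs w" for v
      proof -
        have "k - 3 < k - 1" "k - 1 < k" "k - 1 - (k - 3) = 2" using k3 by linarith+
        then show ?thesis
          using detour[of "k - 3" "k - 1" "[v, w]"] path2[of v w] that w ends(2) last_nth sym
          by (auto simp: e_def)
      qed
      have ep: "\<not> E x e" if x: "x \<in> preds w" "x \<noteq> q" for x
      proof -
        obtain p where p: "p \<in> idx w" "0 < p" "x = vs ! (p - 1)" using x(1) by (rule predsE)
        have "p \<noteq> k - 1"
        proof
          assume "p = k - 1"
          then have "p - 1 = k - 2" by linarith
          then show False using p x by (simp add: q_def)
        qed
        moreover have "p \<noteq> k - 2" "p < k" using p no_pen by (auto simp: idx_def)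
        ultimately have "p < k - 2" by linarith
        then show ?thesis
          using tail(2)[OF tl ws, of p, unfolded pen] p sym by (auto simp: idx_def)
      qed
      have 1: "card {q, e} \<le> a" using False a_pos by (simp add: card_insert_if)
      have 2: "a \<le> card (insert e (preds w))"
        using \<open>e \<notin> preds w\<close> fin_preds c d less by simp
      have eX: "\<not> E e y" if y: "y \<in> X - {q}" for y
      proof
        assume e: "E e y"
        then have "y \<notin> preds w" using y ep[of y] sym[OF e] by auto
        then have "y = w \<or> y \<in> nbrs w" using y by (auto simp: X_def)
        then show False using e ew eu by blast
      qed
      have 3: "\<not> E x y" if "x \<in> {q, e}" "y \<in> insert e X - {q, e}" for x y
        using that iso[OF q, of y] eX[of y] by auto
      have 4: "\<not> E x y" if "x \<in> insert e (preds w) - {q, e}" "y \<in> insert e X" for x y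
        using that iso[of x y] ep[of x] by auto
      have 5: "{q, e} \<subseteq> insert e (preds w)" "insert e (preds w) \<subseteq> insert e X" "insert e X \<subseteq> V"
        using q preds_X X_V e by auto
      show False
        by (rule hole_between[OF 5(3) X_large[OF e_notin] 5(1,2) 1 2 3 4])
    qed
  qed
qed

text \<open>If \<open>w\<close> is not adjacent to \<open>last vs\<close>, reversing the path turns
  this into non-adjacency to its first vertex.\<close>

lemma nbrs_large:
  assumes w: "w \<in> W"
  shows "b \<le> card (nbrs w)"
proof (cases "E w (last vs)")
  case True
  then show ?thesis
    using nbrs_large_if_adj_z nbrs_large_if_not_hd nbrs_large_if_adj_ends assms by blast
next
  case False
  interpret R: stuck_gadget V E a b "rev vs" z by (rule rev_stuck)
  have "R.W = W" by (simp add: W_def R.W_def)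
  then show ?thesis
    using R.nbrs_large_if_not_hd[of w] nbrs_large_if_adj_z[OF w] w False by (auto simp: hd_rev)
qed

section \<open>The neighbours of the path in \<open>W\<close>\<close>

lemma nbrs_consecutive:
  assumes "Suc i < k" "u \<in> nbrs (vs ! i)" "v \<in> nbrs (vs ! Suc i)"
  shows "u \<noteq> v" "\<not> E u v"
proof -
  show "u \<noteq> v"
    using detour[of i "Suc i" "[u]"] assms path1[of u] W_props[of u] sym by auto
  show "\<not> E u v"
    using detour[of i "Suc i" "[u, v]"] assms path2[of u v] sym by auto
qed

text \<open>A common neighbour \<open>u = v\<close> is not excluded here: as a detour it would only
  replace one vertex and keep the order \<open>k\<close>.\<close>

lemma nbrs_distance_two:
  assumes "i + 2 < k" "u \<in> nbrs (vs ! i)" "v \<in> nbrs (vs ! (i + 2))"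
  shows "\<not> E u v"
  using detour[of i "i + 2" "[u, v]"] assms path2[of u v] sym by auto

text \<open>A path in \<open>W\<close> from \<open>u\<close> to \<open>q\<close> on 3 or 4 vertices
  would be a forbidden detour. The hole condition, applied around the neighbourhoods of
  \<open>u\<close> and \<open>q\<close>, produces one.\<close>

lemma nbrs_distance_three:
  assumes i: "i + 3 < k" and u: "u \<in> nbrs (vs ! i)" and q: "q \<in> nbrs (vs ! (i + 3))"
  shows "u = q"
proof (rule ccontr)
  assume "u \<noteq> q"
  have common: False if "v \<in> nbrs u" "v \<in> nbrs q" for v
  proof -
    have "path [u, v, q]"
      using that u q \<open>u \<noteq> q\<close> irrefl W_props sym by (auto simp: path_Cons)
    then show False
      using detour[of i "i + 3" "[u, v, q]"] that u q i sym by auto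
  qed
  have linked: False if "v \<in> nbrs u - {q}" "v' \<in> nbrs q - {u}" "E v v'" for v v'
  proof -
    have "v \<noteq> v'" "v \<noteq> u" "v' \<noteq> q" "v \<in> V" "v' \<in> V" "q \<in> V" "u \<in> V"
      using that irrefl W_props u q by auto
    then have "path [u, v, v', q]"
      using that u q \<open>u \<noteq> q\<close> sym by (auto simp: path_Cons)
    then show False
      using detour[of i "i + 3" "[u, v, v', q]"] that u q i sym by auto
  qed
  define A where "A = insert u (nbrs u - {q})"
  \<comment> \<open>Deleting \<open>u\<close> may leave only \<open>b - 1\<close> vertices. The
    filler \<open>vs ! Suc i\<close> restores the size and has no neighbour in \<open>A\<close>, by
    \<open>nbrs_consecutive\<close>.\<close>
  define B where "B = insert (vs ! Suc i) (nbrs q - {u})"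
  have i': "Suc i < k" using i by simp
  have "u \<in> W" "q \<in> W" using u q by auto
  have vi: "vs ! Suc i \<in> V" "vs ! Suc i \<notin> W" using nth_V[OF i'] i' by (auto simp: W_def)
  have fin_nbrs: "finite (nbrs x)" for x by simp
  have large: "b \<le> Suc (card (nbrs x - {y}))" if "x \<in> W" for x y
    using nbrs_large[OF that] card_Diff1_le[of "nbrs x" y] card_Suc_Diff1[OF fin_nbrs, of y x]
    by (cases "y \<in> nbrs x") auto
  have "card A = Suc (card (nbrs u - {q}))" "card B = Suc (card (nbrs q - {u}))"
    unfolding A_def B_def using irrefl vi by (auto intro: card_insert_disjoint)
  then have "a \<le> card A" "b \<le> card B"
    using large[OF \<open>u \<in> W\<close>, of q] large[OF \<open>q \<in> W\<close>, of u] a_le_b by linarith+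
  moreover have "A \<subseteq> V" "B \<subseteq> V" using \<open>u \<in> W\<close> vi W_props by (auto simp: A_def B_def)
  moreover have "A \<inter> B = {}" using common vi \<open>u \<in> W\<close> by (auto simp: A_def B_def)
  ultimately obtain x y where xy: "x \<in> A" "y \<in> B" "E x y" using hole by metis
  have "\<not> E x (vs ! Suc i)" if "x \<in> A" for x
  proof
    assume "E x (vs ! Suc i)"
    then have "x \<in> nbrs (vs ! Suc i)" using that \<open>u \<in> W\<close> sym by (auto simp: A_def)
    then show False using nbrs_consecutive[OF i' u] that by (auto simp: A_def)
  qed
  then have y: "y \<in> nbrs q - {u}" using xy by (auto simp: B_def)
  then have "x \<noteq> u" using common[of y] xy by auto
  then show False using linked[of x y] y xy by (auto simp: A_def)
qed

definition unseen :: "'a \<Rightarrow> nat set" where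
  "unseen u = {j. j < k \<and> (\<forall>v\<in>nbrs u. \<not> E v (vs ! j))}"

lemma finite_unseen [simp]: "finite (unseen u)"
  by (rule finite_subset[of _ "{..<k}"]) (auto simp: unseen_def)

text \<open>The hole condition between the unseen path vertices and the at least \<open>b\<close>
  neighbours of \<open>u\<close> in \<open>W\<close>.\<close>

lemma card_unseen:
  assumes "u \<in> W"
  shows "card (unseen u) < a"
proof (rule ccontr)
  assume "\<not> ?thesis"
  moreover have "card (nth vs ` unseen u) = card (unseen u)"
    by (rule card_image) (use vs_distinct in \<open>auto simp: inj_on_def unseen_def nth_eq_iff_index_eq\<close>)
  ultimately have "a \<le> card (nth vs ` unseen u)" by simp
  moreover have sub: "nth vs ` unseen u \<subseteq> set vs" by (auto simp: unseen_def)
  moreover have "set vs \<inter> nbrs u = {}" "nbrs u \<subseteq> V" by (auto simp: W_def)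
  ultimately obtain x v where xv: "x \<in> nth vs ` unseen u" "v \<in> nbrs u" "E x v"
    using hole[of "nth vs ` unseen u" "nbrs u"] nbrs_large[OF assms] vs_V by blast
  from xv(1) obtain j where "j \<in> unseen u" "x = vs ! j" by blast
  then show False using xv(2) sym[OF xv(3)] by (simp add: unseen_def)
qed

lemma near_unseen:
  assumes u: "u \<in> nbrs (vs ! i)" and i: "i < k"
  shows "Suc i < k \<Longrightarrow> Suc i \<in> unseen u" "i + 2 < k \<Longrightarrow> i + 2 \<in> unseen u"
    "1 \<le> i \<Longrightarrow> i - 1 \<in> unseen u" "2 \<le> i \<Longrightarrow> i - 2 \<in> unseen u"
proof -
  show "Suc i \<in> unseen u" if "Suc i < k"
    using nbrs_consecutive(2)[OF that u] that sym by (auto simp: unseen_def)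
  show "i + 2 \<in> unseen u" if "i + 2 < k"
    using nbrs_distance_two[OF that u] that sym by (auto simp: unseen_def)
  show "i - 1 \<in> unseen u" if "1 \<le> i"
    using nbrs_consecutive(2)[of "i - 1" _ u] u i that sym by (auto simp: unseen_def)
  show "i - 2 \<in> unseen u" if "2 \<le> i"
  proof -
    have "i - 2 + 2 = i" using that by simp
    then show ?thesis
      using nbrs_distance_two[of "i - 2" _ u] u i sym by (auto simp: unseen_def)
  qed
qed

text \<open>If \<open>vs ! (i - 1)\<close> is adjacent to \<open>vs ! g\<close>, then by
  \<open>cross\<close> no neighbour of \<open>u\<close> in \<open>W\<close> is adjacent to
  \<open>vs ! Suc g\<close>. So its path neighbours are, up to a shift, unseen positions, and there
  are at most \<open>a\<close> of them.\<close>

lemma many_nbrs_pred: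
  assumes u: "u \<in> nbrs (vs ! i)" and i: "1 \<le> i" "i < k"
  shows "b \<le> 2 + card (nbrs (vs ! (i - 1)))"
proof -
  have "u \<in> W" using u by simp
  \<comment> \<open>The position \<open>k - 1\<close> is listed separately because it has no
    successor on the path.\<close>
  have "idx (vs ! (i - 1)) \<subseteq> insert (k - 1) ((\<lambda>j. j - 1) ` unseen u)"
  proof
    fix g
    assume g: "g \<in> idx (vs ! (i - 1))"
    then have gk: "g < k" "E (vs ! (i - 1)) (vs ! g)" by (auto simp: idx_def)
    show "g \<in> insert (k - 1) ((\<lambda>j. j - 1) ` unseen u)"
    proof (rule ccontr)
      assume n: "\<not> ?thesis"
      then have g1: "Suc g < k" using gk by auto
      have "Suc g \<notin> unseen u" using n image_eqI[of g "\<lambda>j. j - 1" "Suc g" "unseen u"] by auto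
      then obtain v where v: "v \<in> nbrs u" "E v (vs ! Suc g)" using g1 by (auto simp: unseen_def)
      have "g \<noteq> i - 1" using gk irrefl by auto
      then consider "Suc g < i" | "i < Suc g" using i by linarith
      then show False
      proof cases
        case 1
        then show False
          using cross[of "Suc g" i "[v, u]"] path2[of v u] v u i gk sym by auto
      next
        case 2
        then show False
          using cross[of i "Suc g" "[u, v]"] path2[of u v] v u i g1 gk sym by auto
      qed
    qed
  qed
  then have "card (idx (vs ! (i - 1))) \<le> card (insert (k - 1) ((\<lambda>j. j - 1) ` unseen u))"
    by (rule card_mono[rotated]) simp
  also have "\<dots> \<le> Suc (card ((\<lambda>j. j - 1) ` unseen u))" by (rule card_insert_le_m1) auto
  also have "\<dots> \<le> Suc (card (unseen u))" by (simp add: card_image_le)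
  finally have "card (idx (vs ! (i - 1))) \<le> a" using card_unseen[OF \<open>u \<in> W\<close>] by linarith
  moreover have "vs ! (i - 1) \<in> V" using nth_V i by simp
  ultimately show ?thesis using min_deg_le[of "vs ! (i - 1)"] by linarith
qed

lemma many_nbrs_succ:
  assumes u: "u \<in> nbrs (vs ! i)" and i: "Suc i < k"
  shows "b \<le> 2 + card (nbrs (vs ! Suc i))"
proof -
  interpret R: stuck_gadget V E a b "rev vs" z by (rule rev_stuck)
  have W: "R.W = W" by (simp add: W_def R.W_def)
  define j where "j = k - 1 - i"
  have j: "1 \<le> j" "j < k" "k - Suc j = i" "k - Suc (j - 1) = Suc i" using i by (auto simp: j_def)
  then have "rev vs ! j = vs ! i" "rev vs ! (j - 1) = vs ! Suc i"
    by (simp_all add: rev_nth)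
  then show ?thesis using R.many_nbrs_pred[of u j, unfolded W] u j(1,2) by simp
qed

text \<open>Without edges between path and \<open>W\<close> the hole condition forces
  \<open>k < a\<close>, but then the degree of \<open>vs ! 0\<close>, at most \<open>k + 1\<close>,
  is too small.\<close>

lemma some_nbr:
  assumes "W \<noteq> {}"
  shows "\<exists>i<k. nbrs (vs ! i) \<noteq> {}"
proof (rule ccontr)
  assume n: "\<not> ?thesis"
  obtain u where u: "u \<in> W" using assms by blast
  have no_edge: "\<not> E x v" if "x \<in> set vs" "v \<in> W" for x v
    using n that by (auto simp: in_set_conv_nth)
  have "card (set vs) = k" using vs_distinct by (simp add: distinct_card)
  moreover have "set vs \<inter> nbrs u = {}" "nbrs u \<subseteq> V" by (auto simp: W_def)
  moreover have "\<not> (\<exists>x\<in>set vs. \<exists>y\<in>nbrs u. E x y)" using no_edge by simp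
  ultimately have "\<not> a \<le> k"
    using hole[of "set vs" "nbrs u"] nbrs_large[OF u] vs_V by argo
  moreover have "card (idx (vs ! 0)) \<le> k"
    using card_mono[of "{..<k}" "idx (vs ! 0)"] by (auto simp: idx_def)
  moreover have k0: "0 < k" using k_ge by linarith
  then have "nbrs (vs ! 0) = {}" using n by blast
  then have "card (nbrs (vs ! 0)) = 0" by (simp only: card.empty)
  moreover have "vs ! 0 \<in> V" using nth_V k0 by blast
  ultimately show False using min_deg_le[of "vs ! 0"] a_le_b k_ge by linarith
qed

lemma card_unseen_ge:
  assumes "finite J" "J \<subseteq> unseen u" "u \<in> W"
  shows "card J < a"
  using card_unseen[OF assms(3)] card_mono[OF finite_unseen assms(2)] by linarith

lemma three_le_a:
  assumes "W \<noteq> {}" "3 \<le> k"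
  shows "3 \<le> a"
proof -
  obtain i u where i: "i < k" and u: "u \<in> nbrs (vs ! i)" using some_nbr[OF assms(1)] by blast
  note near = near_unseen[OF u i]
  consider "i + 2 < k" | "2 \<le> i" | "i = 1" "k = 3" using i assms(2) by linarith
  then have "\<exists>J. J \<subseteq> unseen u \<and> finite J \<and> card J = 2"
  proof cases
    case 1
    then show ?thesis using near(1,2) by (intro exI[of _ "{Suc i, i + 2}"]) auto
  next
    case 2
    then have "i - 1 \<noteq> i - 2" by linarith
    then show ?thesis using near(3,4) 2 by (intro exI[of _ "{i - 1, i - 2}"]) auto
  next
    case 3
    then show ?thesis using near(1,3) by (intro exI[of _ "{Suc i, i - 1}"]) auto
  qed
  then show ?thesis using card_unseen_ge[of _ u] u by fastforce
qed

text \<open>Since \<open>b \<ge> 3\<close>, having a neighbour in \<open>W\<close> spreads along the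
  whole path. Three unseen positions around position 1 raise \<open>a\<close> to at least 4, so
  \<open>vs ! 3\<close> has two neighbours in \<open>W\<close>, while
  \<open>nbrs_distance_three\<close> allows only one.\<close>

lemma short_if_nonempty:
  assumes "W \<noteq> {}"
  shows "k \<le> 3"
proof (rule ccontr)
  assume "\<not> ?thesis"
  then have k4: "4 \<le> k" by simp
  then have k0: "0 < k" by linarith
  have b3: "3 \<le> b" using three_le_a[OF assms] k4 a_le_b by simp
  have step: "nbrs (vs ! Suc i) \<noteq> {} \<longleftrightarrow> nbrs (vs ! i) \<noteq> {}" if "Suc i < k" for i
  proof
    assume "nbrs (vs ! Suc i) \<noteq> {}"
    then have "b \<le> 2 + card (nbrs (vs ! i))" using many_nbrs_pred[of _ "Suc i"] that by auto
    then show "nbrs (vs ! i) \<noteq> {}" using b3 by (metis card.empty add_0_right not_less_eq_eq numeral_2_eq_2 numeral_3_eq_3)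
  next
    assume "nbrs (vs ! i) \<noteq> {}"
    then have "b \<le> 2 + card (nbrs (vs ! Suc i))" using many_nbrs_succ[of _ i] that by auto
    then show "nbrs (vs ! Suc i) \<noteq> {}" using b3 by (metis card.empty add_0_right not_less_eq_eq numeral_2_eq_2 numeral_3_eq_3)
  qed
  have "nbrs (vs ! i) \<noteq> {} \<longleftrightarrow> nbrs (vs ! 0) \<noteq> {}" if "i < k" for i
    using that
  proof (induction i)
    case (Suc i)
    then show ?case using step[of i] by simp
  qed simp
  then have all: "nbrs (vs ! i) \<noteq> {}" if "i < k" for i
    using some_nbr[OF assms] that by blast
  obtain u where u: "u \<in> nbrs (vs ! 1)" using all[of 1] k4 by auto
  have "{0, 2, 3} \<subseteq> unseen u"
    using near_unseen(1-3)[OF u] k4 by (auto simp: numeral_2_eq_2 numeral_3_eq_3)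
  then have "3 < a" using card_unseen_ge[of "{0, 2, 3}" u] u by simp
  obtain v where v: "v \<in> nbrs (vs ! 2)" using all[of 2] k4 by auto
  have "b \<le> 2 + card (nbrs (vs ! 3))" using many_nbrs_succ[OF v] k4 by (simp add: numeral_3_eq_3)
  then have "2 \<le> card (nbrs (vs ! 3))" using \<open>3 < a\<close> a_le_b by linarith
  moreover obtain q where q: "q \<in> nbrs (vs ! 0)" using all[OF k0] by blast
  moreover have "nbrs (vs ! 3) \<subseteq> {q}"
    using nbrs_distance_three[of 0 q] q k4 by auto
  ultimately show False using card_mono[of "{q}" "nbrs (vs ! 3)"] by simp
qed

section \<open>Gadgets of order two and three\<close>

lemma min_deg_vs: "i < k \<Longrightarrow> a + b \<le> k + (if E (vs ! i) z then 1 else 0) + card (nbrs (vs ! i))"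
proof -
  assume i: "i < k"
  have "idx (vs ! i) \<subseteq> {..<k} - {i}" using irrefl by (auto simp: idx_def)
  then have "card (idx (vs ! i)) \<le> card ({..<k} - {i})" by (rule card_mono[rotated]) simp
  also have "\<dots> = k - 1" using i by simp
  finally show ?thesis using min_deg'[of "vs ! i"] nth_V[OF i] i by linarith
qed

text \<open>Allows the vertices of a small gadget to exchange their roles.\<close>

lemma stuck_gadget_other:
  assumes "gadget us y" "length us = k"
  shows "stuck_gadget V E a b us y"
  by unfold_locales (use assms no_gadget in auto)

lemma separated_hole:
  assumes "A \<subseteq> V" "B \<subseteq> V" "a \<le> card A" "b \<le> card B"
    and "\<And>x y. x \<in> A \<Longrightarrow> y \<in> B \<Longrightarrow> x \<noteq> y \<and> \<not> E x y"
  shows False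
  using hole[OF assms(1,2) _ assms(3,4)] assms(5) by blast

lemma separated_succ:
  assumes "Suc i < k" "x \<in> insert (vs ! i) (nbrs (vs ! i))" "y \<in> nbrs (vs ! Suc i)"
  shows "x \<noteq> y \<and> \<not> E x y"
proof -
  have "vs ! i \<notin> W" using assms(1) by (auto simp: W_def)
  then show ?thesis
    using nbrs_consecutive[OF assms(1) _ assms(3)] nbrs_consecutive(1)[OF assms(1), of y y] assms(2,3)
    by blast
qed

lemma separated_pred:
  assumes "Suc i < k" "x \<in> nbrs (vs ! i)" "y \<in> insert (vs ! Suc i) (nbrs (vs ! Suc i))"
  shows "x \<noteq> y \<and> \<not> E x y"
proof -
  have "vs ! Suc i \<notin> W" using assms(1) by (auto simp: W_def)
  then show ?thesis
    using nbrs_consecutive[OF assms(1,2)] nbrs_consecutive(1)[OF assms(1,2), of x] assms(2,3) sym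
    by blast
qed

lemma card_insert_nbrs: "i < k \<Longrightarrow> card (insert (vs ! i) (nbrs (vs ! i))) = Suc (card (nbrs (vs ! i)))"
  by (rule card_insert_disjoint) (auto simp: W_def)

lemma insert_nbrs_V: "i < k \<Longrightarrow> insert (vs ! i) (nbrs (vs ! i)) \<subseteq> V" "nbrs v \<subseteq> V"
  using nth_V W_props by auto

text \<open>Separated neighbourhoods of consecutive path vertices force \<open>a = b = 3\<close> and
  make the middle vertex adjacent to \<open>z\<close>. Then all pairs of path vertices can be
  treated as consecutive, and \<open>Q 1\<close> is separated from
  \<open>P 0 \<union> P 2\<close>.\<close>

lemma not_three:
  assumes "W \<noteq> {}"
  shows "k \<noteq> 3"
proof
  assume k: "k = 3"
  then have a3: "3 \<le> a" using three_le_a assms by simp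
  have i: "0 < k" "1 < k" "2 < k" using k by linarith+
  define P where "P j = nbrs (vs ! j)" for j
  define Q where "Q j = insert (vs ! j) (P j)" for j
  have V: "P j \<subseteq> V" "j < k \<Longrightarrow> Q j \<subseteq> V" for j
    unfolding Q_def P_def by (fact insert_nbrs_V)+
  have fin_P: "finite (P j)" for j by (simp add: P_def)
  have card_Q: "card (Q j) = Suc (card (P j))" if "j < k" for j
    unfolding Q_def P_def by (rule card_insert_nbrs[OF that])
  have succ: "x \<noteq> y \<and> \<not> E x y" if "Suc j < k" "x \<in> Q j" "y \<in> P (Suc j)" for x y j
    using separated_succ that unfolding Q_def P_def by blast
  have pred: "x \<noteq> y \<and> \<not> E x y" if "Suc j < k" "x \<in> P j" "y \<in> Q (Suc j)" for x y j
    using separated_pred that unfolding Q_def P_def by blast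
  have 01: "x \<noteq> y \<and> \<not> E x y" if "x \<in> P 0" "y \<in> Q 1" for x y
    using pred[of 0] that i by simp
  have 10: "x \<noteq> y \<and> \<not> E x y" if "x \<in> P 1" "y \<in> Q 0" for x y
    using succ[of 0 y x] that i E_sym by auto
  have 12: "x \<noteq> y \<and> \<not> E x y" if "x \<in> Q 1" "y \<in> P 2" for x y
    using succ[of 1 x y] that i by (simp add: numeral_2_eq_2)
  have deg: "a + b \<le> 3 + (if E (vs ! j) z then 1 else 0) + card (P j)" if "j < k" for j
    using min_deg_vs[OF that] k unfolding P_def by simp
  have deg': "a + b \<le> 4 + card (P j)" if "j < k" for j
    using deg[OF that] by (simp split: if_splits)
  have "card (P 0) < a"
  proof (rule ccontr)
    assume "\<not> ?thesis"
    moreover have "b \<le> card (Q 1)" using deg'[OF i(2)] card_Q[OF i(2)] a3 by linarith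
    ultimately show False
      using separated_hole[of "P 0" "Q 1"] V i(2) 01 by simp
  qed
  then have ab: "a = 3" "b = 3" using deg'[OF i(1)] a3 a_le_b by linarith+
  have P2: "2 \<le> card (P j)" if "j < k" for j using deg'[OF that] ab by linarith
  have "card (P 1) < 3"
  proof (rule ccontr)
    assume "\<not> ?thesis"
    moreover have "3 \<le> card (Q 0)" using P2[OF i(1)] card_Q[OF i(1)] by linarith
    ultimately show False
      using separated_hole[of "P 1" "Q 0"] V i(1) 10 ab by simp
  qed
  then have v1z: "E (vs ! 1) z" using deg[OF i(2)] ab by (simp split: if_splits)
  \<comment> \<open>Now the path and \<open>z\<close> span a complete graph, so that the path vertices can be permuted.\<close>
  obtain x y w where vs: "vs = [x, y, w]"
    using k by (auto simp: length_Suc_conv numeral_3_eq_3)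
  have "gadget [y, x, w] z"
    using vs_path closing z_last z_notin v1z sym vs by (auto simp: gadget_def path_Cons)
  then interpret R: stuck_gadget V E a b "[y, x, w]" z
    by (rule stuck_gadget_other) (simp add: k)
  have "set vs = {x, y, w}" by (simp add: vs)
  then have W: "R.W = W" unfolding W_def R.W_def by auto
  \<comment> \<open>The ends \<open>x\<close> and \<open>w\<close> of \<open>vs\<close> are
    consecutive on the reordered path.\<close>
  have "u \<noteq> v" if "u \<in> P 0" "v \<in> P 2" for u v
    using R.nbrs_consecutive(1)[of 1 u v] that unfolding P_def W vs by simp
  then have "card (P 0 \<union> P 2) = card (P 0) + card (P 2)"
    using fin_P by (intro card_Un_disjoint) auto
  then have "b \<le> card (P 0 \<union> P 2)" using P2[OF i(1)] P2[OF i(3)] ab by linarith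
  moreover have "a \<le> card (Q 1)" using P2[OF i(2)] card_Q[OF i(2)] ab by linarith
  moreover have "x \<noteq> y \<and> \<not> E x y" if "x \<in> Q 1" "y \<in> P 0 \<union> P 2" for x y
    using that 01[of y x] 12[of x y] E_sym by auto
  ultimately show False
    using separated_hole[of "Q 1" "P 0 \<union> P 2"] V i(2) by simp
qed

text \<open>Any edge of the triangle can serve as the path. So the neighbourhoods of its vertices in
  \<open>W\<close> are pairwise separated or disjoint as needed, and two of them together are large
  enough against the third with its vertex.\<close>

lemma not_two:
  assumes "W \<noteq> {}"
  shows "k \<noteq> 2"
proof
  assume k: "k = 2"
  obtain x y where vs: "vs = [x, y]"
    using k by (auto simp: length_Suc_conv numeral_2_eq_2)
  have e: "E x y" "E z x" "E z y" "x \<in> V" "y \<in> V"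
    using closing z_hd z_last sym vs_V vs by auto
  have ne: "x \<noteq> y" "x \<noteq> z" "y \<noteq> z" using e irrefl by auto
  have "gadget [x, z] y" "gadget [y, z] x"
    using e ne z_V sym by (auto simp: gadget_def path_Cons)
  then have st: "stuck_gadget V E a b [x, z] y" "stuck_gadget V E a b [y, z] x"
    by (simp_all add: stuck_gadget_other k)
  interpret R0: stuck_gadget V E a b "[x, z]" y by (rule st(1))
  interpret R1: stuck_gadget V E a b "[y, z]" x by (rule st(2))
  have "set vs = {x, y}" by (simp add: vs)
  then have W: "R0.W = W" "R1.W = W" unfolding W_def R0.W_def R1.W_def by auto
  have a2: "2 \<le> a"
  proof -
    obtain j u where j: "j < k" and u: "u \<in> nbrs (vs ! j)" using some_nbr[OF assms] by blast
    have "j = 0 \<or> j = 1" using j k by linarith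
    then have "{1 - j} \<subseteq> unseen u" using near_unseen(1,3)[OF u j] k by auto
    then show ?thesis using card_unseen_ge[of "{1 - j}" u] u by simp
  qed
  define P where "P v = nbrs v" for v
  have V: "P v \<subseteq> V" for v
    unfolding P_def by (fact insert_nbrs_V(2))
  have fin_P: "finite (P v)" for v by (simp add: P_def)
  have c: "a + b \<le> 3 + card (P x)" "a + b \<le> 3 + card (P y)"
    using min_deg_vs[of 0] min_deg_vs[of 1] unfolding P_def vs by (simp_all split: if_splits)
  have cz: "a + b \<le> 3 + card (P z)"
    using R0.min_deg_vs[of 1] unfolding P_def W by (simp split: if_splits)
  have Q: "card (insert x (P x)) = Suc (card (P x))"
    using card_insert_nbrs[of 0] unfolding P_def vs by simp
  have "u \<noteq> v" if "u \<in> P y" "v \<in> P z" for u v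
    using R1.nbrs_consecutive(1)[of 0 u v] that unfolding P_def W by simp
  then have "card (P y \<union> P z) = card (P y) + card (P z)"
    using fin_P by (intro card_Un_disjoint) auto
  then have large: "b \<le> card (P y \<union> P z)" using c cz a2 a_le_b by linarith
  have large': "a \<le> card (insert x (P x))" using Q c a2 a_le_b by linarith
  have xy: "u \<noteq> v \<and> \<not> E u v" if "u \<in> insert x (P x)" "v \<in> P y" for u v
    using that separated_succ[of 0 u v] unfolding P_def vs by simp
  have xz: "u \<noteq> v \<and> \<not> E u v" if "u \<in> insert x (P x)" "v \<in> P z" for u v
    using that R0.separated_succ[of 0 u v] unfolding P_def W by simp
  have "insert x (P x) \<subseteq> V" "P y \<union> P z \<subseteq> V" using V e(4) by simp_all
  then show False
  proof (rule separated_hole[OF _ _ large' large])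
    fix u v
    assume "u \<in> insert x (P x)" "v \<in> P y \<union> P z"
    then show "u \<noteq> v \<and> \<not> E u v" using xy xz by (elim UnE)
  qed
qed

lemma W_empty: "W = {}"
  using short_if_nonempty not_three not_two k_ge by fastforce

end

section \<open>From gadgets to pancyclicity\<close>

context hole_free_graph
begin

lemma has_gadget_step:
  assumes "has_gadget k" "k + 1 < card V"
  shows "has_gadget (k + 1) \<or> has_gadget (k + 2)"
proof (rule ccontr)
  assume n: "\<not> ?thesis"
  obtain vs z where vs: "length vs = k" "gadget vs z" using assms(1) by (auto simp: has_gadget_def)
  interpret S: stuck_gadget V E a b vs z
    by unfold_locales (use n vs in \<open>auto simp: has_gadget_def\<close>)
  have "V \<subseteq> insert z (set vs)" using S.W_empty by (auto simp: S.W_def)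
  then have "card V \<le> card (insert z (set vs))" by (rule card_mono[rotated]) simp
  also have "\<dots> \<le> Suc (length vs)" by (simp add: card_insert_if card_length le_SucI)
  finally show False using assms vs by simp
qed

lemma pancyclic_if_triangle:
  assumes "E x y" "E y z" "E x z"
  shows "pancyclic V E"
proof -
  have "gadget [x, y] z"
    using assms edge_in[OF assms(1)] irrefl sym by (auto simp: gadget_def path_Cons)
  then have two: "has_gadget 2" unfolding has_gadget_def by (intro exI[of _ "[x, y]"]) auto
  \<comment> \<open>A step may skip one order, so the induction keeps a gadget at one of two
    consecutive orders. Length \<open>l\<close> then comes from order \<open>l - 1\<close> or from
    order \<open>l\<close>.\<close>
  have *: "has_gadget j \<or> has_gadget (j + 1)" if "2 \<le> j" "j < card V" for j
    using that
  proof (induction j rule: dec_induct)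
    case (step j)
    then show ?case using has_gadget_step[of j] by auto
  qed (use two in simp)
  have "has_cycle_of_length V E l" if "3 \<le> l" "l \<le> card V" for l
  proof -
    have l: "2 \<le> l - 1" "l - 1 < card V" "Suc (l - 1) = l" using that by linarith+
    then have "has_gadget (l - 1) \<or> has_gadget l" using *[OF l(1,2)] by simp
    then show ?thesis
      using has_gadget_cycle(1)[of "l - 1"] has_gadget_cycle(2)[of l] that l(3) by auto
  qed
  then show ?thesis by (simp add: pancyclic_def)
qed

end

theorem theorem1p2:
  fixes V :: "'a set" and E :: "'a \<Rightarrow> 'a \<Rightarrow> bool"
  assumes "simple_graph V E"
    and "min_degree V E \<ge> bip_indep_number V E"
  shows "pancyclic V E \<or> is_balanced_complete_bipartite V E"
proof (cases "V = {}")
  case True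
  then show ?thesis by (simp add: pancyclic_def)
next
  case False
  have G: "finite V" "\<And>x y. E x y \<Longrightarrow> x \<in> V \<and> y \<in> V" "\<And>x y. E x y \<Longrightarrow> E y x" "\<And>x. \<not> E x x"
    using assms(1) by (auto simp: simple_graph_def)
  define hole_free where "hole_free a b \<longleftrightarrow> (\<forall>A B. A \<subseteq> V \<and> B \<subseteq> V \<and> A \<inter> B = {} \<and> card A = a \<and> card B = b
    \<longrightarrow> (\<exists>x\<in>A. \<exists>y\<in>B. E x y))" for a b
  define good where "good k \<longleftrightarrow> (\<exists>a b. a > 0 \<and> b > 0 \<and> a + b = k + 1 \<and> hole_free a b)" for k
  \<comment> \<open>No subset of \<open>V\<close> is this large, so the condition holds vacuously.
    This witness makes the \<open>LEAST\<close> in \<open>bip_indep_number\<close> well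
    defined.\<close>
  have "hole_free (Suc (card V)) 1"
    using card_mono[OF G(1)] unfolding hole_free_def by (metis Suc_n_not_le_n)
  then have "good (Suc (card V))" unfolding good_def by (intro exI[of _ "Suc (card V)"] exI[of _ 1]) auto
  moreover have "bip_indep_number V E = (LEAST k. good k)"
    unfolding bip_indep_number_def good_def hole_free_def ..
  ultimately have "good (bip_indep_number V E)" by (simp add: LeastI)
  then obtain a b where ab: "a > 0" "b > 0" "a + b = bip_indep_number V E + 1" "hole_free a b"
    by (auto simp: good_def)
  have hole_sym: "hole_free b a" unfolding hole_free_def
  proof (intro allI impI)
    fix A B
    assume "A \<subseteq> V \<and> B \<subseteq> V \<and> A \<inter> B = {} \<and> card A = b \<and> card B = a"
    then have "\<exists>x\<in>B. \<exists>y\<in>A. E x y" using ab(4) unfolding hole_free_def by blast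
    then show "\<exists>x\<in>A. \<exists>y\<in>B. E x y" using G(3) by blast
  qed
  have deg: "bip_indep_number V E \<le> card {u. E v u}" if "v \<in> V" for v
  proof -
    have "min_degree V E \<le> degree V E v" unfolding min_degree_def using that G(1) by (intro Min_le) auto
    moreover have "{u \<in> V. E v u} = {u. E v u}" using G(2) by blast
    ultimately show ?thesis using assms(2) by (simp add: degree_def)
  qed
  \<comment> \<open>The definition does not order the two sizes, whereas the locale requires the
    smaller one first; \<open>hole_sym\<close> permits the exchange.\<close>
  define c d where "c = min a b" and "d = max a b"
  have "hole_free c d" using ab(4) hole_sym by (simp add: c_def d_def min_def max_def)
  moreover have "1 \<le> c" "c \<le> d" "c + d = bip_indep_number V E + 1" using ab(1-3) by (auto simp: c_def d_def)
  ultimately interpret hole_free_graph V E c d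
    using G deg by unfold_locales (auto simp: hole_free_def)
  show ?thesis using triangle_or_bipartite[OF False] pancyclic_if_triangle by blast
qed

end
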